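(* The 2-color Rado number of $L(m,3)$ equals $C(m,3)=\left\lceil \frac{m-1}{3}\left\lceil \frac{m-1}{3}\right\rceil\right\rceil$ for every integer $m\geq 7$. For $m=6,5,4,3$ the 2-color Rado number of $L(m,3)$ is $5,4,1,9$, respectively.
   Context: For integers $m\geq 3$, $a\geq 1$, $L(m,a)$ denotes the equation $x_1+x_2+\cdots+x_{m-1}=a x_m$. For a positive integer $n$, $[n]=\{1,\dots,n\}$. A solution of $L(m,a)$ in $[n]$ is an $m$-tuple $(x_1,\dots,x_m)\in[n]^m$ (entries not necessarily distinct) satisfying the equation; given a 2-coloring of $[n]$, it is monochromatic if all $x_i$ have the same color. The 2-color Rado number of $L(m,a)$ is the least positive integer $n$ such that every 2-coloring of $[n]$ admits a monochromatic solution of $L(m,a)$ in $[n]$. *)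

theory Defs
  imports Complex_Main
begin

(* A solution of L(m,a): x_1+...+x_{m-1} = a*x_m, represented as a list xs of
   length m, xs!0..xs!(m-2) are x_1..x_{m-1} and xs!(m-1) is x_m. *)
definition is_solution_L :: "nat \<Rightarrow> nat \<Rightarrow> nat list \<Rightarrow> bool" where
  "is_solution_L m a xs \<longleftrightarrow> length xs = m \<and>
     (\<Sum>i<m - 1. xs ! i) = a * xs ! (m - 1)"

definition rado_property :: "nat \<Rightarrow> nat \<Rightarrow> nat \<Rightarrow> bool" where
  "rado_property m a n \<longleftrightarrow>
     (\<forall>c :: nat \<Rightarrow> bool. \<exists>xs. is_solution_L m a xs \<and> set xs \<subseteq> {1..n} \<and>
        (\<exists>b. \<forall>x\<in>set xs. c x = b))"

definition is_rado_number :: "nat \<Rightarrow> nat \<Rightarrow> nat \<Rightarrow> bool" where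
  "is_rado_number m a n \<longleftrightarrow> n \<ge> 1 \<and> rado_property m a n \<and>
     (\<forall>k. 1 \<le> k \<and> k < n \<longrightarrow> \<not> rado_property m a k)"

end

theory Submission
  imports Defs
begin

text \<open>
  Write k = m - 1 and q for the ceiling of k/3. Colouring the numbers below q red and the others
  blue gives the lower bound. For the upper bound, let 1 be red and k \<ge> 7. If 1, ..., y - 1 are
  red, then every x between k - 2 and (k - 2)(y - 1) is blue, because 3x is x + x plus a sum of
  k - 2 numbers below y; in particular k - 2 is blue.

  \<^item> If 2 and 3 are blue, then 3(k - 2) is a sum of k twos and threes.
  \<^item> If 2 is blue and 3 is red, every x of the same parity as k with k \<le> 3x \<le> 3k is blue, and
    3k is the sum of k - 3 twos and three such numbers.
  \<^item> If 2 is red, let y be the least blue number, so that 3 \<le> y \<le> q. The least Z with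
    3Z \<ge> (k - 1)y + q is blue and at most the claimed Rado number, and 3Z is the sum of k - 1
    copies of y and one of the blue numbers q, q + 1, q + 2.
\<close>

section \<open>Preliminaries: sums of numbers from an interval, reformulation of the Rado
  property\<close>

lemma exists_list_sum_in_interval:
  fixes lo hi s k :: nat
  assumes "k * lo \<le> s" "s \<le> k * hi" "lo \<le> hi"
  shows "\<exists>ys. length ys = k \<and> set ys \<subseteq> {lo..hi} \<and> sum_list ys = s"
  using assms
proof (induction k arbitrary: s)
  case 0
  then show ?case by simp
next
  case (Suc k)
  \<comment> \<open>Greedy choice: the largest entry up to \<open>hi\<close> that still leaves
    \<open>k * lo\<close> for the \<open>k\<close> remaining ones.\<close>
  define x where "x = min hi (s - k * lo)"
  have "lo \<le> x" "x \<le> hi" "x \<le> s" "k * lo \<le> s - x" "s - x \<le> k * hi"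
    using Suc.prems mult_le_mono2[OF Suc.prems(3), of k] by (auto simp: x_def min_def)
  moreover obtain ys where "length ys = k" "set ys \<subseteq> {lo..hi}" "sum_list ys = s - x"
    using Suc.IH[of "s - x"] Suc.prems(3) calculation by blast
  ultimately show ?case
    by (intro exI[of _ "x # ys"]) auto
qed

text \<open>Splitting off the right-hand variable \<open>x\<close> turns the indexed sum into
  \<open>sum_list\<close>, and \<open>c x\<close> itself can serve as the common colour
  \<open>b\<close>.\<close>

lemma rado_property_Suc_iff:
  "rado_property (Suc k) a n \<longleftrightarrow>
     (\<forall>c :: nat \<Rightarrow> bool. \<exists>ys x. length ys = k \<and> sum_list ys = a * x \<and> x \<in> {1..n} \<and>
        set ys \<subseteq> {1..n} \<and> (\<forall>y\<in>set ys. c y = c x))"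
proof -
  have "(\<exists>xs. is_solution_L (Suc k) a xs \<and> set xs \<subseteq> {1..n} \<and> (\<exists>b. \<forall>x\<in>set xs. c x = b)) \<longleftrightarrow>
    (\<exists>ys x. length ys = k \<and> sum_list ys = a * x \<and> x \<in> {1..n} \<and>
        set ys \<subseteq> {1..n} \<and> (\<forall>y\<in>set ys. c y = c x))" (is "?L \<longleftrightarrow> ?R") for c :: "nat \<Rightarrow> bool"
  proof
    assume ?L
    then obtain xs b where xs: "length xs = Suc k" "(\<Sum>i<k. xs ! i) = a * xs ! k"
      "set xs \<subseteq> {1..n}" "\<forall>x\<in>set xs. c x = b"
      by (auto simp: is_solution_L_def)
    obtain ys x where eq: "xs = ys @ [x]"
      using xs(1) by (metis length_Suc_conv_rev)
    then have "sum_list ys = (\<Sum>i<k. xs ! i)"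
      using xs(1) by (simp add: sum_list_sum_nth atLeast0LessThan nth_append)
    then show ?R
      using xs eq by (intro exI[of _ ys] exI[of _ x]) (auto simp: nth_append)
  next
    assume ?R
    then obtain ys x where "length ys = k" "sum_list ys = a * x" "x \<in> {1..n}"
      "set ys \<subseteq> {1..n}" "\<forall>y\<in>set ys. c y = c x"
      by blast
    then show ?L
      by (intro exI[of _ "ys @ [x]"])
        (auto simp: is_solution_L_def sum_list_sum_nth atLeast0LessThan nth_append)
  qed
  then show ?thesis
    by (simp add: rado_property_def)
qed

lemma rado_property_mono:
  assumes "rado_property m a n" "n \<le> n'"
  shows "rado_property m a n'"
  unfolding rado_property_def
proof
  fix c :: "nat \<Rightarrow> bool"
  obtain xs where "is_solution_L m a xs" "set xs \<subseteq> {1..n}" "\<exists>b. \<forall>x\<in>set xs. c x = b"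
    using assms(1)[unfolded rado_property_def, rule_format, of c] by blast
  moreover have "{1..n} \<subseteq> {1..n'}" using assms(2) by simp
  ultimately show "\<exists>xs. is_solution_L m a xs \<and> set xs \<subseteq> {1..n'} \<and> (\<exists>b. \<forall>x\<in>set xs. c x = b)"
    by (intro exI[of _ xs]) auto
qed

lemma is_rado_numberI:
  assumes "rado_property m a n" "1 \<le> n" "n = 1 \<or> \<not> rado_property m a (n - 1)"
  shows "is_rado_number m a n"
proof -
  have "\<not> rado_property m a k" if "1 \<le> k" "k < n" for k
  proof -
    have "k \<le> n - 1" "n \<noteq> 1" using that by linarith+
    then show ?thesis using assms(3) rado_property_mono by blast
  qed
  then show ?thesis using assms by (simp add: is_rado_number_def)
qed

text \<open>The assumptions bound \<open>q\<close> and \<open>n\<close> by the ceilings of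
  \<open>k/3\<close> and \<open>k * q/3\<close>. A solution in numbers below \<open>q\<close> would
  have \<open>3 * x\<close> at least \<open>k\<close>, hence \<open>x\<close> at least
  \<open>q\<close>; one in numbers from \<open>q\<close> on has \<open>3 * x\<close> at least
  \<open>k * q\<close>, hence \<open>x\<close> at least \<open>n\<close>.\<close>

lemma not_rado_property_below:
  fixes k q n :: nat
  assumes "3 * q < k + 3" "3 * n < k * q + 3" "1 \<le> n"
  shows "\<not> rado_property (Suc k) 3 (n - 1)"
proof
  assume "rado_property (Suc k) 3 (n - 1)"
  then obtain ys x where ys: "length ys = k" "sum_list ys = 3 * x" "x \<in> {1..n - 1}"
    "set ys \<subseteq> {1..n - 1}" "\<forall>y\<in>set ys. (y < q) = (x < q)"
    unfolding rado_property_Suc_iff by (drule_tac x = "\<lambda>y. y < q" in spec) blast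
  have lb: "k * l \<le> sum_list ys" if "\<forall>y\<in>set ys. l \<le> y" for l
    using sum_list_mono[of ys "\<lambda>_. l" "\<lambda>y. y"] that ys(1) by (simp add: sum_list_triv)
  show False
  proof (cases "x < q")
    case True
    then show False using lb[of 1] ys assms by fastforce
  next
    case False
    then have "k * q \<le> 3 * x" using lb[of q] ys by force
    then show False using ys(3) assms by auto
  qed
qed

section \<open>Upper bound: constraints on a colouring without monochromatic solutions\<close>

locale solution_free_colouring =
  fixes c :: "nat \<Rightarrow> bool" and k n :: nat
  assumes no_solution: "\<And>ys x. length ys = k \<Longrightarrow> sum_list ys = 3 * x \<Longrightarrow> x \<in> {1..n} \<Longrightarrow>
    set ys \<subseteq> {1..n} \<Longrightarrow> \<forall>y\<in>set ys. c y = c x \<Longrightarrow> False"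
begin

text \<open>In this form the simplifier evaluates a concrete list to a purely propositional
  constraint on colours.\<close>

lemma no_solution_conj:
  "\<not> (length ys = k \<and> sum_list ys = 3 * x \<and> x \<in> {1..n} \<and> set ys \<subseteq> {1..n} \<and>
     (\<forall>y\<in>set ys. c y = c x))"
  by (intro notI, elim conjE) (rule no_solution)

lemma interval_forces:
  assumes "\<forall>y\<in>{lo..hi}. c y = b" "1 \<le> lo" "lo \<le> hi" "hi \<le> n"
    and "k * lo \<le> 3 * x" "3 * x \<le> k * hi" "x \<in> {1..n}"
  shows "c x \<noteq> b"
proof
  assume "c x = b"
  moreover obtain ys where "length ys = k" "set ys \<subseteq> {lo..hi}" "sum_list ys = 3 * x"
    using exists_list_sum_in_interval[of k lo "3 * x" hi] assms by blast
  ultimately show False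
    using no_solution[of ys x] assms by fastforce
qed

text \<open>Using \<open>x\<close> twice on the left reduces \<open>3 * x\<close> to
  \<open>x\<close>, so only \<open>k - 2\<close> entries of the interval have to sum to
  \<open>x\<close>. This reaches larger \<open>x\<close> than \<open>interval_forces\<close>
  does.\<close>

lemma interval_forces_doubling:
  assumes "\<forall>y\<in>{lo..hi}. c y = b" "1 \<le> lo" "lo \<le> hi" "hi \<le> n" "2 \<le> k"
    and "(k - 2) * lo \<le> x" "x \<le> (k - 2) * hi" "x \<in> {1..n}"
  shows "c x \<noteq> b"
proof
  assume "c x = b"
  moreover obtain ys where "length ys = k - 2" "set ys \<subseteq> {lo..hi}" "sum_list ys = x"
    using exists_list_sum_in_interval[of "k - 2" lo x hi] assms by blast
  ultimately show False
    using no_solution[of "x # x # ys" x] assms by fastforce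
qed

lemma two_blue_contradiction:
  assumes "7 \<le> k" "k \<le> n" "c 2 \<noteq> c 1"
  shows False
proof (cases "c 3 = c 1")
  case False
  have "k - 2 \<in> {1..n}" using assms by auto
  then have "c (k - 2) \<noteq> c 1"
    using interval_forces_doubling[of 1 1 "c 1" "k - 2"] assms by auto
  moreover have "\<forall>y\<in>{2..3}. c y = c 2"
    using assms False by (auto simp: numeral_eq_Suc le_Suc_eq)
  then have "c (k - 2) \<noteq> c 2"
    by (rule interval_forces) (use assms in auto)
  ultimately show False using assms by blast
next
  case True
  have blue: "c x \<noteq> c 1" if x: "k \<le> 3 * x" "x \<le> k" "even (x + k)" for x
  proof
    assume cx: "c x = c 1"
    have "even (3 * x - k)" using x by simp
    \<comment> \<open>Replacing a 1 by a 3 raises the sum by 2, so \<open>j\<close> threes and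
      \<open>k - j\<close> ones give \<open>3 * x\<close>.\<close>
    then obtain j where j: "3 * x - k = 2 * j" by blast
    show False
      by (rule no_solution[of "replicate j 3 @ replicate (k - j) 1" x])
        (use cx True j x assms in \<open>auto simp: sum_list_replicate\<close>)
  qed
  \<comment> \<open>The least number of the parity of \<open>k\<close> that is at least
    \<open>k/3\<close>.\<close>
  define s where "s = (if even ((k + 2) div 3 + k) then (k + 2) div 3 else (k + 2) div 3 + 1)"
  have s: "k \<le> 3 * s" "3 * s \<le> k + 5" "even (s + k)"
    by (auto simp: s_def)
  \<comment> \<open>Chosen so that \<open>s + s + t + 2 * (k - 3) = 3 * k\<close>; the bounds on
    \<open>s\<close> keep \<open>t\<close> between \<open>k/3\<close> and \<open>k\<close>.\<close>
  define t where "t = k + 6 - 2 * s"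
  have "3 \<le> s" "2 * s \<le> k + 6" using s assms(1) by linarith+
  then have t: "t + 2 * s = k + 6" "k \<le> 3 * t" "t \<le> k" "even (t + k)"
    using s by (simp_all add: t_def)
  have "c s \<noteq> c 1" "c t \<noteq> c 1" "c k \<noteq> c 1"
    using blue[of s] blue[of t] blue[of k] s t assms by auto
  then show False
    by (intro no_solution[of "s # s # t # replicate (k - 3) 2" k])
      (use s t assms in \<open>auto simp: sum_list_replicate\<close>)
qed

lemma two_red_contradiction:
  assumes "7 \<le> k" "k \<le> n" "c 2 = c 1"
    and q: "k \<le> 3 * q" "3 * q < k + 3" and n: "k * q \<le> 3 * n"
  shows False
proof -
  have q_le: "q \<le> n" "3 \<le> q" "q + 2 \<le> k" using q assms by auto
  \<comment> \<open>If all of 1, ..., \<open>q\<close> were red,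
    \<open>k \<le> 3 * q \<le> k * q\<close> would force \<open>q\<close> to be blue.\<close>
  have "\<exists>y. y \<in> {1..q} \<and> c y \<noteq> c 1"
  proof (rule ccontr)
    assume "\<nexists>y. y \<in> {1..q} \<and> c y \<noteq> c 1"
    then have red: "\<forall>y\<in>{1..q}. c y = c 1" by blast
    have "3 * q \<le> k * q" using assms by simp
    then have "c q \<noteq> c 1"
      by (intro interval_forces[OF red]) (use q q_le in simp_all)
    moreover have "q \<in> {1..q}" using q_le by simp
    ultimately show False using red by blast
  qed
  then obtain y where y: "y \<in> {1..q}" "c y \<noteq> c 1" and
    min: "\<forall>z<y. \<not> (z \<in> {1..q} \<and> c z \<noteq> c 1)"
    by (subst (asm) exists_least_iff) blast
  have "y \<noteq> 1" "y \<noteq> 2" using y assms by auto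
  then obtain w where w: "y = Suc w" "2 \<le> w" using y by (cases y) auto
  have red: "\<forall>z\<in>{1..w}. c z = c 1"
  proof
    fix z assume "z \<in> {1..w}"
    then have "z < y" "z \<in> {1..q}" using y w by auto
    then show "c z = c 1" using min by blast
  qed
  have blue1: "c x \<noteq> c 1" if "k \<le> 3 * x" "3 * x \<le> k * w" "x \<le> n" for x
    by (rule interval_forces[OF red]) (use that y w q_le assms in auto)
  have blue2: "c x \<noteq> c 1" if "k - 2 \<le> x" "x \<le> (k - 2) * w" "x \<le> n" for x
    by (rule interval_forces_doubling[OF red]) (use that y w q_le assms in auto)
  define Z where "Z = ((k - 1) * y + q + 2) div 3"
  \<comment> \<open>The rounding error in \<open>Z\<close>; adding it to \<open>q\<close> makes the
    sum exactly \<open>3 * Z\<close>.\<close>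
  define e where "e = 3 * Z - ((k - 1) * y + q)"
  have Z: "3 * Z = (k - 1) * y + q + e" "e \<le> 2" unfolding e_def Z_def by auto
  have "(k - 1) * y + q \<le> (k - 1) * q + q" using y by simp
  also have "\<dots> = k * q" using assms by (cases k) auto
  finally have Zn: "Z \<le> n" using n unfolding Z_def by linarith
  \<comment> \<open>Writing \<open>k = j + 7\<close> and \<open>w = v + 2\<close> removes truncated
    subtraction, so the bounds on \<open>Z\<close> can be compared after expanding products.\<close>
  obtain j where j: "k = j + 7" using assms by (metis le_Suc_ex add.commute)
  obtain v where v: "w = v + 2" using w by (metis le_Suc_ex add.commute)
  have "c Z \<noteq> c 1"
  proof (rule blue2)
    show "k - 2 \<le> Z" using Z j v w by (simp add: algebra_simps)
    show "Z \<le> (k - 2) * w" using Z j v w q by (simp add: algebra_simps)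
  qed (fact Zn)
  moreover have "c (q + e) \<noteq> c 1"
  \<comment> \<open>In general \<open>3 * (q + e)\<close> is at most \<open>k + 8\<close>, which is
    at most \<open>2 * k\<close> only from \<open>k = 8\<close> on. For \<open>k = 7\<close>,
    \<open>(k - 1) * y + q = 6 * y + 3\<close> is divisible by 3, so \<open>e = 0\<close>.\<close>
  proof (cases "k = 7")
    case True
    then have "q = 3" using q by simp
    then have "e = 0" using Z True y w by simp presburger
    then show ?thesis using \<open>q = 3\<close> True w q_le blue1[of q] by auto
  next
    case False
    then have "8 \<le> k" using assms(1) by simp
    then have "3 * (q + e) \<le> k * 2" using q(2) Z(2) by simp
    also have "k * 2 \<le> k * w" using w by simp
    finally have "3 * (q + e) \<le> k * w" .
    moreover have "q + e \<le> n" using Z(2) q_le assms(2) by linarith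
    ultimately show ?thesis using blue1[of "q + e"] q by simp
  qed
  ultimately show False
    by (intro no_solution[of "(q + e) # replicate (k - 1) y" Z])
      (use Z Zn y q_le assms in \<open>auto simp: sum_list_replicate\<close>)
qed

end

lemma rado_property_iff_no_solution_free_colouring:
  "rado_property (Suc k) 3 n \<longleftrightarrow> (\<nexists>c. solution_free_colouring c k n)"
  by (simp add: rado_property_Suc_iff solution_free_colouring_def)

text \<open>The inequalities say that \<open>q\<close> and \<open>n\<close> are the ceilings of
  \<open>k/3\<close> and \<open>k * q/3\<close>. The upper bound splits on whether 1 and 2 share a
  colour.\<close>

lemma is_rado_number_large:
  fixes k q n :: nat
  assumes "7 \<le> k" and q: "k \<le> 3 * q" "3 * q < k + 3" and n: "k * q \<le> 3 * n" "3 * n < k * q + 3"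
  shows "is_rado_number (Suc k) 3 n"
proof -
  have "k * 3 \<le> k * q" using assms by simp
  then have "k \<le> n" using n by linarith
  then have "rado_property (Suc k) 3 n"
    unfolding rado_property_iff_no_solution_free_colouring
    using solution_free_colouring.two_blue_contradiction
      solution_free_colouring.two_red_contradiction assms by blast
  then show ?thesis
    using is_rado_numberI not_rado_property_below[of q k n] \<open>k \<le> n\<close> assms by simp
qed

section \<open>The small cases, with explicit solutions and colourings\<close>

lemma rado_number_7: "is_rado_number 7 3 4"
proof (rule is_rado_numberI)
  have False if "solution_free_colouring c 6 4" for c
  proof -
    interpret solution_free_colouring c 6 4 by fact
    show False
      using no_solution_conj[of "[1,1,1,1,1,1]" 2, simplified] no_solution_conj[of "[4,4,1,1,1,1]" 4, simplified]
        no_solution_conj[of "[2,2,2,2,2,2]" 4, simplified] by argo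
  qed
  then show "rado_property 7 3 4"
    using rado_property_iff_no_solution_free_colouring[of 6 4] by auto
  show "4 = 1 \<or> \<not> rado_property 7 3 (4 - 1)"
    using not_rado_property_below[of 2 6 4] by simp
qed simp

lemma rado_number_6: "is_rado_number 6 3 5"
proof (rule is_rado_numberI)
  have False if "solution_free_colouring c 5 5" for c
  proof -
    interpret solution_free_colouring c 5 5 by fact
    show False
      using no_solution_conj[of "[3,3,1,1,1]" 3, simplified] no_solution_conj[of "[2,1,1,1,1]" 2, simplified]
        no_solution_conj[of "[2,2,2,3,3]" 4, simplified] no_solution_conj[of "[3,3,3,3,3]" 5, simplified]
        no_solution_conj[of "[4,5,1,1,1]" 4, simplified] by argo
  qed
  then show "rado_property 6 3 5"
    using rado_property_iff_no_solution_free_colouring[of 5 5] by auto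
  \<comment> \<open>Five numbers from {1,4} sum to 2 modulo 3; five from {2,3} sum to at least 10,
    more than \<open>3 * 3\<close>.\<close>
  have "solution_free_colouring (\<lambda>x. x \<in> {1,4}) 5 4"
  proof
    fix ys :: "nat list" and x
    assume *: "length ys = 5" "sum_list ys = 3 * x" "x \<in> {1..4}" "set ys \<subseteq> {1..4}"
      "\<forall>y\<in>set ys. (y \<in> {1,4}) = (x \<in> {1,4})"
    have "(\<forall>y\<in>set (x # ys). y \<in> {1,4}) \<or> (\<forall>y\<in>set (x # ys). y \<in> {2,3})"
      using *(3-5) by (auto simp: subset_iff numeral_eq_Suc le_Suc_eq)
    moreover obtain a b c d e where "ys = [a,b,c,d,e]"
      using *(1) by (auto simp: numeral_eq_Suc length_Suc_conv)
    ultimately show False using *(2) by auto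
  qed
  then show "5 = 1 \<or> \<not> rado_property 6 3 (5 - 1)"
    using rado_property_iff_no_solution_free_colouring[of 5 4] by auto
qed simp

lemma rado_number_5: "is_rado_number 5 3 4"
proof (rule is_rado_numberI)
  have False if "solution_free_colouring c 4 4" for c
  proof -
    interpret solution_free_colouring c 4 4 by fact
    show False
      using no_solution_conj[of "[2,2,1,1]" 2, simplified] no_solution_conj[of "[2,2,2,3]" 3, simplified]
        no_solution_conj[of "[4,4,2,2]" 4, simplified] no_solution_conj[of "[1,1,3,4]" 3, simplified] by argo
  qed
  then show "rado_property 5 3 4"
    using rado_property_iff_no_solution_free_colouring[of 4 4] by auto
  \<comment> \<open>Four odd numbers have an even sum, while \<open>3 * x\<close> is odd for odd
    \<open>x\<close>; four twos sum to 8, not 6.\<close>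
  have "solution_free_colouring (\<lambda>x. x = 2) 4 3"
  proof
    fix ys :: "nat list" and x
    assume *: "length ys = 4" "sum_list ys = 3 * x" "x \<in> {1..3}" "set ys \<subseteq> {1..3}"
      "\<forall>y\<in>set ys. (y = 2) = (x = 2)"
    have "(\<forall>y\<in>set (x # ys). y \<in> {1,3}) \<or> (\<forall>y\<in>set (x # ys). y = 2)"
      using *(3-5) by (auto simp: subset_iff numeral_eq_Suc le_Suc_eq)
    moreover obtain a b c d where "ys = [a,b,c,d]"
      using *(1) by (auto simp: numeral_eq_Suc length_Suc_conv)
    ultimately show False using *(2) by auto
  qed
  then show "4 = 1 \<or> \<not> rado_property 5 3 (4 - 1)"
    using rado_property_iff_no_solution_free_colouring[of 4 3] by auto
qed simp

lemma rado_number_4: "is_rado_number 4 3 1"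
proof (rule is_rado_numberI)
  have False if "solution_free_colouring c 3 1" for c
    using solution_free_colouring.no_solution[OF that, of "[1,1,1]" 1] by auto
  then show "rado_property 4 3 1"
    using rado_property_iff_no_solution_free_colouring[of 3 1] by auto
qed simp_all

lemma rado_number_3: "is_rado_number 3 3 9"
proof (rule is_rado_numberI)
  have False if "solution_free_colouring c 2 9" for c
  proof -
    interpret solution_free_colouring c 2 9 by fact
    have "c 4 \<noteq> c 2" using no_solution[of "[2,4]" 2] by auto
    moreover have "c 3 \<noteq> c 2" using no_solution[of "[3,3]" 2] by auto
    moreover have "c 6 \<noteq> c 3" using no_solution[of "[3,6]" 3] by auto
    moreover have "\<not> (c 4 = c 3 \<and> c 5 = c 3)" using no_solution[of "[4,5]" 3] by auto
    moreover have "\<not> (c 6 = c 5 \<and> c 9 = c 5)" using no_solution[of "[6,9]" 5] by auto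
    moreover have "\<not> (c 3 = c 4 \<and> c 9 = c 4)" using no_solution[of "[3,9]" 4] by auto
    ultimately show False by argo
  qed
  then show "rado_property 3 3 9"
    using rado_property_iff_no_solution_free_colouring[of 2 9] by auto
  \<comment> \<open>Within each class the only pair sum divisible by 3 is 3 + 3, respectively 6 + 6;
    these need \<open>x = 2\<close> and \<open>x = 4\<close>, both of the opposite colour.\<close>
  have "solution_free_colouring (\<lambda>x. x \<in> {1,3,4,7}) 2 8"
  proof
    fix ys :: "nat list" and x
    assume *: "length ys = 2" "sum_list ys = 3 * x" "x \<in> {1..8}" "set ys \<subseteq> {1..8}"
      "\<forall>y\<in>set ys. (y \<in> {1,3,4,7}) = (x \<in> {1,3,4,7})"
    have blue: "y \<in> {2,5,6,8}" if "y \<in> {1..8}" "y \<notin> {1,3,4,7}" for y :: nat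
      using that by auto
    obtain a b where ys: "ys = [a,b]"
      using *(1) by (auto simp: numeral_eq_Suc length_Suc_conv)
    show False
    proof (cases "x \<in> {1,3,4,7}")
      case True
      then have "a \<in> {1,3,4,7}" "b \<in> {1,3,4,7}" using *(5) ys by simp_all
      then show False using True *(2) ys by auto
    next
      case False
      then have "a \<in> {2,5,6,8}" "b \<in> {2,5,6,8}" "x \<in> {2,5,6,8}"
        using *(3-5) ys by (intro blue; simp)+
      then show False using *(2) ys by auto
    qed
  qed
  then show "9 = 1 \<or> \<not> rado_property 3 3 (9 - 1)"
    using rado_property_iff_no_solution_free_colouring[of 2 8] by auto
qed simp

theorem theorem2:
  shows "(\<forall>m::nat. m \<ge> 7 \<longrightarrow>
            is_rado_number m 3
              (nat \<lceil>(real (m - 1) / 3) * real_of_int \<lceil>real (m - 1) / 3\<rceil>\<rceil>))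
         \<and> is_rado_number 6 3 5 \<and> is_rado_number 5 3 4
         \<and> is_rado_number 4 3 1 \<and> is_rado_number 3 3 9"
proof (intro conjI allI impI)
  fix m :: nat
  assume "7 \<le> m"
  then obtain k where k: "m = Suc k" "6 \<le> k" by (cases m) auto
  define q where "q = (k + 2) div 3"
  define n where "n = (k * q + 2) div 3"
  have q: "k \<le> 3 * q" "3 * q < k + 3" unfolding q_def by auto
  have n: "k * q \<le> 3 * n" "3 * n < k * q + 3" unfolding n_def by auto
  have "\<lceil>real k / 3\<rceil> = int q"
    using q by (intro ceiling_unique) auto
  moreover have "real (k * q) \<le> real (3 * n)" "real (3 * n) < real (k * q + 3)"
    using n by (simp_all only: of_nat_le_iff of_nat_less_iff)
  then have "\<lceil>real k / 3 * real q\<rceil> = int n"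
    by (intro ceiling_unique) auto
  ultimately have eq: "nat \<lceil>(real (m - 1) / 3) * real_of_int \<lceil>real (m - 1) / 3\<rceil>\<rceil> = n"
    using k by simp
  have "is_rado_number m 3 n"
  \<comment> \<open>The formula already holds for \<open>k = 6\<close>, where it gives
    \<open>q = 2\<close> and \<open>n = 4\<close>, but the general argument starts at
    \<open>k = 7\<close>.\<close>
  proof (cases "k = 6")
    case True
    then show ?thesis using k rado_number_7 by (simp add: n_def q_def)
  next
    case False
    then show ?thesis using is_rado_number_large[of k q n] k q n by simp
  qed
  then show "is_rado_number m 3
      (nat \<lceil>(real (m - 1) / 3) * real_of_int \<lceil>real (m - 1) / 3\<rceil>\<rceil>)"
    by (simp only: eq)
qed (fact rado_number_6 rado_number_5 rado_number_4 rado_number_3)+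

end
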